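(* For every $\alpha \in \mathbb{R} \setminus \mathbb{Q}$ there exists a sequence of integers $\{m_l\}_{l \in \mathbb{N}}$ such that $\|m_l \alpha\| \to 0$ as $l \to \infty$ and such that, for every $\theta \in \mathbb{R}$, the set $\{ m_l \theta \bmod 1 : l \in \mathbb{N}\}$ is dense in $\mathbb{T}$ if and only if $\theta \notin \mathbb{Q}\alpha + \mathbb{Q}$.
   Context: $\mathbb{T} = \mathbb{R}/\mathbb{Z}$ is the circle. For $x \in \mathbb{R}$, $\|x\| := \inf_{n \in \mathbb{Z}} |x - n|$ is the distance from $x$ to the nearest integer, and $x \bmod 1$ denotes the fractional part of $x$, viewed as a point of $\mathbb{T}$. $\mathbb{Q}\alpha + \mathbb{Q} = \{ a\alpha + b : a, b \in \mathbb{Q}\}$. *)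

theory Defs
  imports "HOL-Analysis.Analysis"
begin

(* The circle is the quotient group of the reals by the integers with the quotient topology;
   mod_one is the projection. *)

quotient_type circle = real / "\<lambda>x y. x - y \<in> \<int>"
  morphisms rep_circle mod_one
proof (rule equivpI)
  show "reflp (\<lambda>x y :: real. x - y \<in> \<int>)"
    by (simp add: reflp_def)
  show "symp (\<lambda>x y :: real. x - y \<in> \<int>)"
  proof (rule sympI)
    fix x y :: real
    assume "x - y \<in> \<int>"
    then have "- (x - y) \<in> \<int>" by (rule Ints_minus)
    then show "y - x \<in> \<int>" by simp
  qed
  show "transp (\<lambda>x y :: real. x - y \<in> \<int>)"
  proof (rule transpI)
    fix x y z :: real
    assume "x - y \<in> \<int>" "y - z \<in> \<int>"
    then have "(x - y) + (y - z) \<in> \<int>" by (rule Ints_add)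
    then show "x - z \<in> \<int>" by simp
  qed
qed

lemma mod_one_eq_iff: "mod_one x = mod_one y \<longleftrightarrow> x - y \<in> \<int>"
  by (rule circle.abs_eq_iff)

instantiation circle :: topological_space
begin

definition open_circle :: "circle set \<Rightarrow> bool"
  where "open_circle U \<longleftrightarrow> open (mod_one -` U)"

instance
proof
  show "open (UNIV :: circle set)"
    by (simp add: open_circle_def)
next
  fix S T :: "circle set"
  assume "open S" "open T"
  then show "open (S \<inter> T)"
    by (simp add: open_circle_def open_Int)
next
  fix K :: "circle set set"
  assume "\<forall>S\<in>K. open S"
  then show "open (\<Union>K)"
    by (auto simp: open_circle_def vimage_Union)
qed

end

(* Distance to the nearest integer. *)

definition int_norm :: "real \<Rightarrow> real"
  where "int_norm x = (INF n::int. \<bar>x - of_int n\<bar>)"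

end

theory Submission
  imports Defs
begin

text \<open>
  The sequence runs through finite sets \<open>F k\<close> of integers \<open>m\<close> with
  \<open>int_norm (m * \<alpha>) < 1 / (k + 1)\<close>, so that \<open>m * \<alpha>\<close> tends to zero modulo one. It has to be dense
  for uncountably many \<open>\<theta>\<close> at once, and the set of these \<open>\<theta>\<close> is not \<open>\<sigma>\<close>-compact (it is a
  co-countable \<open>G\<^sub>\<delta>\<close> with dense complement), so one cannot exhaust it by compact sets and ask
  that \<open>F k\<close> serve every \<open>\<theta>\<close> from some \<open>k\<close> on. It is enough that each \<open>\<theta>\<close> be served by
  infinitely many \<open>F k\<close>, and this can be arranged as follows.

  Fix a precision \<open>\<epsilon>\<close>. By a quantitative Kronecker theorem
  (\<open>Kronecker_two_dim_bounded_relations\<close>), the multiples \<open>m * \<theta>\<close> with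
  \<open>int_norm (m * \<alpha>) < \<epsilon>\<close> are \<open>\<epsilon>\<close>-dense modulo one unless there is a relation
  \<open>a * \<alpha> + b * \<theta> \<in> \<int>\<close> with small integers \<open>a\<close>, \<open>b\<close>, not both zero, where "small" depends on
  \<open>\<epsilon>\<close> alone. (Longer relations do no harm: they confine the orbit of \<open>(\<alpha>, \<theta>)\<close> to a closed
  subgroup of the torus, but one that already comes close to every point.)
  As \<open>\<alpha>\<close> is irrational, only finitely many \<open>\<theta> \<in> {0..1}\<close> satisfy a small relation (\<open>finite_resonant\<close>), and all of them lie in the
  rational span of \<open>\<alpha>\<close> and \<open>1\<close>. Away from an arbitrarily small neighbourhood of these points,
  compactness yields one finite set of multipliers for all \<open>\<theta>\<close>
  (\<open>finite_multipliers_off_resonances\<close>).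

  So at stage \<open>k\<close> the bad \<open>\<theta>\<close> are those within \<open>r k\<close> of a finite set \<open>B k\<close>, where the sets \<open>B k\<close>
  increase and the radii can be prescribed at will. If \<open>r k\<close> is small compared with the gaps of
  \<open>B k\<close> and of \<open>B (k + 1)\<close>, a point that is bad at all late stages always stays near the same
  element of \<open>B k\<close>, hence is equal to it (\<open>finite_chain_shrinking_radii\<close>). Every \<open>\<theta>\<close> outside the
  rational span is therefore good infinitely often, which is density.

  Conversely, if \<open>\<theta>\<close> lies in the rational span, some multiple \<open>d * \<theta>\<close> is an integral combination
  of \<open>\<alpha>\<close> and \<open>1\<close>. Then \<open>d * m * \<theta>\<close> tends to zero modulo one along the sequence, and the points
  \<open>m * \<theta>\<close> accumulate only at multiples of \<open>1 / d\<close>.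
\<close>

section \<open>Distance to the nearest integer\<close>

lemma int_norm_eq_round: "int_norm x = \<bar>x - of_int (round x)\<bar>"
  unfolding int_norm_def
proof (rule cInf_eq_minimum)
  show "\<bar>x - of_int (round x)\<bar> \<in> range (\<lambda>n. \<bar>x - of_int n\<bar>)" by blast
qed (auto intro: round_diff_minimal)

lemma int_norm_nonneg: "int_norm x \<ge> 0"
  by (simp add: int_norm_eq_round)

lemma int_norm_le_abs_diff: "int_norm x \<le> \<bar>x - of_int n\<bar>"
  by (simp add: int_norm_eq_round round_diff_minimal)

lemma int_norm_less_iff: "int_norm x < e \<longleftrightarrow> (\<exists>n. \<bar>x - of_int n\<bar> < e)"
  using int_norm_le_abs_diff[of x] int_norm_eq_round[of x] by (metis le_less_trans)

lemma int_norm_pos: "x \<notin> \<int> \<Longrightarrow> int_norm x > 0"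
  unfolding int_norm_eq_round by (metis Ints_of_int eq_iff_diff_eq_0 zero_less_abs_iff)

lemma int_norm_add_of_int: "int_norm (x + of_int n) = int_norm x"
proof -
  have "int_norm (x + of_int n) \<le> int_norm x"
    using int_norm_le_abs_diff[of "x + of_int n" "round x + n"] by (simp add: int_norm_eq_round)
  moreover have "int_norm x \<le> int_norm (x + of_int n)"
    using int_norm_le_abs_diff[of x "round (x + of_int n) - n"]
    by (simp add: int_norm_eq_round algebra_simps)
  ultimately show ?thesis by simp
qed

lemma int_norm_of_int_mult_le: "int_norm (of_int k * x) \<le> \<bar>of_int k\<bar> * int_norm x"
proof -
  have "int_norm (of_int k * x) \<le> \<bar>of_int k * x - of_int (k * round x)\<bar>"
    by (rule int_norm_le_abs_diff)
  also have "\<dots> = \<bar>of_int k\<bar> * int_norm x"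
    by (simp add: int_norm_eq_round abs_mult[symmetric] algebra_simps)
  finally show ?thesis .
qed

lemma int_norm_triangle: "int_norm x \<le> int_norm z + int_norm (z - x)"
proof -
  have "int_norm x \<le> \<bar>x - of_int (round z - round (z - x))\<bar>" by (rule int_norm_le_abs_diff)
  also have "\<dots> \<le> int_norm z + int_norm (z - x)" unfolding int_norm_eq_round by simp
  finally show ?thesis .
qed

section \<open>A quantitative form of Kronecker's theorem\<close>

text \<open>
  Such a pair \<open>(a, b)\<close> is a nontrivial frequency, of degree at most \<open>N\<close> in each variable, that
  does not average out along the orbit of \<open>(\<alpha>, \<theta>)\<close>.
\<close>

definition short_relation :: "nat \<Rightarrow> real \<Rightarrow> real \<Rightarrow> bool"
  where "short_relation N \<alpha> \<theta> \<longleftrightarrow> (\<exists>a b :: int. \<bar>a\<bar> \<le> int N \<and> \<bar>b\<bar> \<le> int N \<and>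
            \<not> (a = 0 \<and> b = 0) \<and> of_int a * \<alpha> + of_int b * \<theta> \<in> \<int>)"

text \<open>
  Weyl's observation: apart from the trivial character, a geometric sum on the unit circle stays
  bounded, so its mean vanishes in the limit.
\<close>

lemma mean_of_powers_tendsto:
  fixes z :: complex
  assumes "norm z = 1"
  shows "(\<lambda>M. (\<Sum>m<M. z ^ m) / of_nat M) \<longlonglongrightarrow> (if z = 1 then 1 else 0)"
proof (cases "z = 1")
  case True
  have "\<forall>\<^sub>F M :: nat in sequentially. (1::complex) = (\<Sum>m<M. z ^ m) / of_nat M"
    using eventually_gt_at_top[of 0] by eventually_elim (simp add: True)
  then show ?thesis using True by (simp add: tendsto_eventually eventually_mono)
next
  case False
  have bound: "norm ((\<Sum>m<M. z ^ m) / of_nat M) \<le> 2 / norm (z - 1) / real M" for M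
  proof -
    have "norm (\<Sum>m<M. z ^ m) = norm (z ^ M - 1) / norm (z - 1)"
      using False by (simp add: geometric_sum norm_divide)
    also have "\<dots> \<le> 2 / norm (z - 1)"
      using norm_triangle_ineq4[of "z ^ M" 1] assms
      by (intro divide_right_mono) (auto simp: norm_power)
    finally show ?thesis
      unfolding norm_divide norm_of_nat by (rule divide_right_mono) simp
  qed
  have "(\<lambda>M. 2 / norm (z - 1) / real M) \<longlonglongrightarrow> 0"
    by (intro tendsto_divide_0[OF tendsto_const] filterlim_at_top_imp_at_infinity
        filterlim_real_sequentially)
  then have "(\<lambda>M. (\<Sum>m<M. z ^ m) / of_nat M) \<longlonglongrightarrow> 0"
    by (rule Lim_null_comparison[OF always_eventually, OF allI, OF bound])
  then show ?thesis using False by simp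
qed

lemma cis_2pi_eq_1_iff: "cis (2 * pi * x) = 1 \<longleftrightarrow> x \<in> \<int>"
proof
  assume "cis (2 * pi * x) = 1"
  then have "cos (2 * pi * x) = 1" by (metis cis.sel(1) one_complex.sel(1))
  then obtain n :: int where "2 * pi * x = of_int n * 2 * pi" by (auto simp: cos_one_2pi_int)
  then show "x \<in> \<int>" by simp
qed simp

text \<open>
  The test function of the Kronecker argument is this power of a cosine: it has period one, peaks at
  the integers, and the binomial theorem exhibits it as a trigonometric polynomial of degree \<open>n\<close>
  whose constant coefficient is a central binomial coefficient.
\<close>

lemma cos_power_eq_sum_cis:
  "of_real (cos (pi * x) ^ (2 * n)) =
     (\<Sum>j\<le>2*n. of_real (real (2 * n choose j) / 4 ^ n) * cis (2 * pi * (real_of_int (int j - int n) * x)))"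
proof -
  have "complex_of_real (cos (pi * x)) = (cis (pi * x) + cis (- (pi * x))) / 2"
    by (simp add: complex_eq_iff)
  then have "of_real (cos (pi * x) ^ (2 * n)) = (cis (pi * x) + cis (- (pi * x))) ^ (2 * n) / 4 ^ n"
    unfolding of_real_power by (simp only: power_divide) (simp add: power_mult)
  also have "\<dots> = (\<Sum>j\<le>2*n. of_nat (2 * n choose j) * cis (pi * x) ^ j * cis (- (pi * x)) ^ (2 * n - j)) / 4 ^ n"
    by (simp add: binomial_ring)
  also have "\<dots> = (\<Sum>j\<le>2*n. of_real (real (2 * n choose j) / 4 ^ n) * cis (2 * pi * (real_of_int (int j - int n) * x)))"
    unfolding sum_divide_distrib
  proof (intro sum.cong refl)
    fix j assume "j \<in> {..2*n}"
    then have "cis (pi * x) ^ j * cis (- (pi * x)) ^ (2 * n - j)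
        = cis (2 * pi * (real_of_int (int j - int n) * x))"
      by (simp add: Complex.DeMoivre cis_mult of_nat_diff algebra_simps)
    then show "of_nat (2 * n choose j) * cis (pi * x) ^ j * cis (- (pi * x)) ^ (2 * n - j) / 4 ^ n
        = of_real (real (2 * n choose j) / 4 ^ n) * cis (2 * pi * (real_of_int (int j - int n) * x))"
      by (simp add: mult.assoc)
  qed
  finally show ?thesis .
qed

text \<open>
  The mean over an orbit without short relations picks out the constant Fourier coefficient, because
  every other frequency of the test function contributes a nontrivial geometric sum.
\<close>

lemma mean_of_cos_powers_tendsto:
  fixes \<alpha> \<theta> y :: real
  assumes indep: "\<not> short_relation n \<alpha> \<theta>"
  shows "(\<lambda>M. (\<Sum>m<M. cos (pi * (real m * \<alpha>)) ^ (2 * n) * cos (pi * (real m * \<theta> - y)) ^ (2 * n)) / real M)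
           \<longlonglongrightarrow> (real (2 * n choose n) / 4 ^ n)\<^sup>2"
proof -
  define c where "c j = complex_of_real (real (2 * n choose j) / 4 ^ n)" for j
  define w where "w k = cis (2 * pi * (real_of_int (int k - int n) * (- y)))" for k
  define z where "z j k = cis (2 * pi * (real_of_int (int j - int n) * \<alpha> + real_of_int (int k - int n) * \<theta>))" for j k
  let ?P = "\<lambda>m. cos (pi * (real m * \<alpha>)) ^ (2 * n) * cos (pi * (real m * \<theta> - y)) ^ (2 * n)"
  have P: "complex_of_real (?P m) = (\<Sum>j\<le>2*n. \<Sum>k\<le>2*n. c j * c k * w k * z j k ^ m)" for m
  proof -
    have "complex_of_real (?P m) = of_real (cos (pi * (real m * \<alpha>)) ^ (2 * n)) * of_real (cos (pi * (real m * \<theta> - y)) ^ (2 * n))"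
      by simp
    also have "\<dots> = (\<Sum>j\<le>2*n. \<Sum>k\<le>2*n. (c j * cis (2 * pi * (real_of_int (int j - int n) * (real m * \<alpha>)))) *
        (c k * cis (2 * pi * (real_of_int (int k - int n) * (real m * \<theta> - y)))))"
      by (simp only: cos_power_eq_sum_cis sum_product c_def)
    also have "\<dots> = (\<Sum>j\<le>2*n. \<Sum>k\<le>2*n. c j * c k * w k * z j k ^ m)"
    proof (intro sum.cong refl)
      fix j k
      have "cis (2 * pi * (real_of_int (int j - int n) * (real m * \<alpha>))) *
          cis (2 * pi * (real_of_int (int k - int n) * (real m * \<theta> - y))) = w k * z j k ^ m"
        unfolding w_def z_def unfolding Complex.DeMoivre cis_mult by (rule arg_cong[of _ _ cis]) (simp add: algebra_simps)
      then show "(c j * cis (2 * pi * (real_of_int (int j - int n) * (real m * \<alpha>)))) *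
        (c k * cis (2 * pi * (real_of_int (int k - int n) * (real m * \<theta> - y)))) = c j * c k * w k * z j k ^ m"
        by (simp add: algebra_simps)
    qed
    finally show ?thesis .
  qed
  have mean: "complex_of_real ((\<Sum>m<M. ?P m) / real M)
      = (\<Sum>j\<le>2*n. \<Sum>k\<le>2*n. c j * c k * w k * ((\<Sum>m<M. z j k ^ m) / of_nat M))" for M
  proof -
    have "complex_of_real (\<Sum>m<M. ?P m) = (\<Sum>m<M. \<Sum>j\<le>2*n. \<Sum>k\<le>2*n. c j * c k * w k * z j k ^ m)"
      by (simp only: of_real_sum P)
    also have "\<dots> = (\<Sum>j\<le>2*n. \<Sum>m<M. \<Sum>k\<le>2*n. c j * c k * w k * z j k ^ m)"
      by (rule sum.swap)
    also have "\<dots> = (\<Sum>j\<le>2*n. \<Sum>k\<le>2*n. \<Sum>m<M. c j * c k * w k * z j k ^ m)"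
      by (intro sum.cong refl sum.swap)
    finally have swapped: "complex_of_real (\<Sum>m<M. ?P m) = (\<Sum>j\<le>2*n. \<Sum>k\<le>2*n. \<Sum>m<M. c j * c k * w k * z j k ^ m)" .
    show ?thesis
      unfolding of_real_divide of_real_of_nat_eq swapped
      by (simp only: sum_divide_distrib sum_distrib_left times_divide_eq_right)
  qed
  have z1: "z j k = 1 \<longleftrightarrow> j = n \<and> k = n" if "j \<le> 2*n" "k \<le> 2*n" for j k
  proof -
    have "\<bar>int j - int n\<bar> \<le> int n" "\<bar>int k - int n\<bar> \<le> int n" using that by auto
    with indep have "int j - int n = 0 \<and> int k - int n = 0"
        if "of_int (int j - int n) * \<alpha> + of_int (int k - int n) * \<theta> \<in> \<int>"
      using that unfolding short_relation_def by blast
    then show ?thesis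
      unfolding z_def cis_2pi_eq_1_iff by auto
  qed
  have "(\<lambda>M. complex_of_real ((\<Sum>m<M. ?P m) / real M)) \<longlonglongrightarrow>
      (\<Sum>j\<le>2*n. \<Sum>k\<le>2*n. c j * c k * w k * (if z j k = 1 then 1 else 0))"
    unfolding mean by (intro tendsto_sum tendsto_mult tendsto_const mean_of_powers_tendsto) (simp add: z_def)
  also have "(\<Sum>j\<le>2*n. \<Sum>k\<le>2*n. c j * c k * w k * (if z j k = 1 then 1 else 0))
      = (\<Sum>j\<le>2*n. \<Sum>k\<le>2*n. if k = n then (if j = n then c n * c n else 0) else 0)"
    by (intro sum.cong refl) (auto simp: z1 w_def)
  also have "\<dots> = of_real ((real (2 * n choose n) / 4 ^ n)\<^sup>2)"
    by (simp add: sum.delta c_def power2_eq_square)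
  finally show ?thesis by (simp only: tendsto_of_real_iff)
qed

lemma abs_cos_pi_le:
  assumes "0 < \<epsilon>" "\<epsilon> \<le> 1/2" "int_norm x \<ge> \<epsilon>"
  shows "\<bar>cos (pi * x)\<bar> \<le> cos (pi * \<epsilon>)"
proof -
  define s where "s = x - of_int (round x)"
  have s: "\<epsilon> \<le> \<bar>s\<bar>" "\<bar>s\<bar> \<le> 1/2"
    using assms of_int_round_abs_le[of x] by (auto simp: int_norm_eq_round s_def abs_minus_commute)
  have "pi * x = pi * s + pi * of_int (round x)" by (simp add: s_def algebra_simps)
  then have "\<bar>cos (pi * x)\<bar> = \<bar>cos (pi * s)\<bar> * \<bar>cos (pi * of_int (round x))\<bar>"
    by (simp add: cos_add abs_mult sin_npi_int)
  also have "\<dots> \<le> \<bar>cos (pi * s)\<bar>"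
    by (simp add: mult_left_le)
  also have "\<dots> = \<bar>cos (pi * \<bar>s\<bar>)\<bar>" by (metis abs_if cos_minus mult_minus_right)
  also have "\<dots> = cos (pi * \<bar>s\<bar>)"
    using s by (intro abs_of_nonneg cos_ge_zero) (auto intro: order_trans[of _ 0])
  also have "\<dots> \<le> cos (pi * \<epsilon>)"
    using s assms by (intro cos_monotone_0_pi_le) auto
  finally show ?thesis .
qed

text \<open>
  If every point of the orbit missed the \<open>\<epsilon>\<close>-box around the target, then at each of them one
  of the two cosines would be at most \<open>s\<close> in absolute value, for some \<open>s < 1\<close> that depends only on
  \<open>\<epsilon>\<close>, and the mean of the test function would be at most \<open>s ^ (2 * n)\<close>. But this mean is the square of a normalised
  central binomial coefficient, which decays only polynomially in \<open>n\<close>. Hence a large \<open>n\<close>, chosen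
  from \<open>\<epsilon>\<close> alone, gives a contradiction.
\<close>

theorem Kronecker_two_dim_bounded_relations:
  fixes \<epsilon> :: real
  assumes "\<epsilon> > 0"
  obtains N :: nat where "\<And>\<alpha> \<theta> y :: real.
    \<not> short_relation N \<alpha> \<theta> \<Longrightarrow> \<exists>m::nat. int_norm (real m * \<alpha>) < \<epsilon> \<and> int_norm (real m * \<theta> - y) < \<epsilon>"
proof -
  \<comment> \<open>No real number is further than \<open>1/2\<close> from the integers, and the cosine bound needs this range.\<close>
  define \<delta> where "\<delta> = min \<epsilon> (1/2)"
  have \<delta>: "0 < \<delta>" "\<delta> \<le> 1/2" "\<delta> \<le> \<epsilon>" using assms by (auto simp: \<delta>_def)
  define s where "s = cos (pi * \<delta>)"
  have s: "0 \<le> s" "s < 1"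
    using \<delta> cos_monotone_0_pi[of 0 "pi * \<delta>"] by (auto simp: s_def intro!: cos_ge_zero intro: order_trans[of _ 0])
  have "(\<lambda>n. 2 * (real n * s ^ n)) \<longlonglongrightarrow> 2 * 0"
    using s by (intro tendsto_mult tendsto_const powser_times_n_limit_0) auto
  then have "\<forall>\<^sub>F n in sequentially. 2 * (real n * s ^ n) < 1"
    by (rule order_tendstoD) simp
  with eventually_gt_at_top[of 0] have "\<forall>\<^sub>F n in sequentially. 0 < n \<and> 2 * (real n * s ^ n) < 1"
    by (rule eventually_conj)
  then obtain n :: nat where n: "0 < n" "2 * (real n * s ^ n) < 1"
    unfolding eventually_sequentially by blast
  let ?c = "real (2 * n choose n) / 4 ^ n"
  have c: "s ^ n < ?c"
  proof -
    have "1 / (2 * real n) \<le> ?c"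
      using central_binomial_lower_bound[OF n(1)] by (simp add: field_simps)
    moreover have "s ^ n < 1 / (2 * real n)" using n by (simp add: field_simps)
    ultimately show ?thesis by linarith
  qed
  show thesis
  proof (rule that[of n], rule ccontr)
    fix \<alpha> \<theta> y :: real
    assume indep: "\<not> short_relation n \<alpha> \<theta>"
    assume "\<not> (\<exists>m::nat. int_norm (real m * \<alpha>) < \<epsilon> \<and> int_norm (real m * \<theta> - y) < \<epsilon>)"
    then have far: "\<delta> \<le> int_norm (real m * \<alpha>) \<or> \<delta> \<le> int_norm (real m * \<theta> - y)" for m :: nat
      using \<delta>(3) by (meson not_le order_trans less_le_trans)
    let ?P = "\<lambda>m. cos (pi * (real m * \<alpha>)) ^ (2 * n) * cos (pi * (real m * \<theta> - y)) ^ (2 * n)"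
    have P: "?P m \<le> s ^ (2 * n)" for m
    proof -
      have le: "cos (pi * x) ^ (2 * n) \<le> s ^ (2 * n)" if "\<delta> \<le> int_norm x" for x
        using power_mono[OF abs_cos_pi_le[OF \<delta>(1,2) that], of "2 * n"]
        by (simp add: s_def power_even_abs)
      have 1: "cos t ^ (2 * n) \<le> 1" for t :: real
        using power_mono[of "\<bar>cos t\<bar>" 1 "2 * n"] by (simp add: power_even_abs)
      have 0: "0 \<le> cos t ^ (2 * n)" for t :: real by (simp add: power_mult)
      from far[of m] show ?thesis
      proof
        assume "\<delta> \<le> int_norm (real m * \<alpha>)"
        from mult_mono[OF le[OF this] 1] show ?thesis using 0 s by fastforce
      next
        assume "\<delta> \<le> int_norm (real m * \<theta> - y)"
        from mult_mono[OF 1 le[OF this]] show ?thesis using 0 s by fastforce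
      qed
    qed
    have "(\<Sum>m<M. ?P m) / real M \<le> s ^ (2 * n)" if "M > 0" for M
      using sum_bounded_above[of "{..<M}" ?P "s ^ (2 * n)"] P that by (simp add: field_simps)
    then have "\<forall>\<^sub>F M in sequentially. (\<Sum>m<M. ?P m) / real M \<le> s ^ (2 * n)"
      by (rule eventually_mono[OF eventually_gt_at_top[of 0]])
    with mean_of_cos_powers_tendsto[of n \<alpha> \<theta> y, OF indep] have "?c\<^sup>2 \<le> s ^ (2 * n)"
      by (rule tendsto_upperbound) (rule trivial_limit_sequentially)
    then have "?c\<^sup>2 \<le> (s ^ n)\<^sup>2" by (simp only: power_even_eq)
    moreover have "(s ^ n)\<^sup>2 < ?c\<^sup>2" using c s by (intro power_strict_mono) auto
    ultimately show False by simp
  qed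
qed

section \<open>Resonant points\<close>

definition resonant :: "real \<Rightarrow> nat \<Rightarrow> real set"
  where "resonant \<alpha> N = {\<theta> \<in> {0..1}. short_relation N \<alpha> \<theta>}"

lemma mono_resonant: "mono (resonant \<alpha>)"
proof (intro monoI subsetI)
  fix M N \<theta>
  assume "M \<le> N" "\<theta> \<in> resonant \<alpha> M"
  moreover from this obtain a b :: int where "\<bar>a\<bar> \<le> int M" "\<bar>b\<bar> \<le> int M" "\<not> (a = 0 \<and> b = 0)"
      "of_int a * \<alpha> + of_int b * \<theta> \<in> \<int>"
    unfolding resonant_def short_relation_def by blast
  moreover from this \<open>M \<le> N\<close> have "\<bar>a\<bar> \<le> int N" "\<bar>b\<bar> \<le> int N" by linarith+
  ultimately show "\<theta> \<in> resonant \<alpha> N" unfolding resonant_def short_relation_def by blast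
qed

lemma relation_coeff_nonzero:
  fixes a b :: int
  assumes "\<alpha> \<notin> \<rat>" "\<not> (a = 0 \<and> b = 0)" "of_int a * \<alpha> + of_int b * \<theta> \<in> \<int>"
  shows "b \<noteq> 0"
proof
  assume "b = 0"
  then have "a \<noteq> 0" "of_int a * \<alpha> \<in> \<rat>" using assms Ints_subset_Rats by auto
  then have "of_int a * \<alpha> / of_int a \<in> \<rat>" by (intro Rats_divide) auto
  with \<open>a \<noteq> 0\<close> assms(1) show False by simp
qed

lemma resonant_subset_span:
  assumes "\<alpha> \<notin> \<rat>"
  shows "resonant \<alpha> N \<subseteq> {a * \<alpha> + b | a b. a \<in> \<rat> \<and> b \<in> \<rat>}"
proof
  fix \<theta> assume "\<theta> \<in> resonant \<alpha> N"
  then obtain a b :: int where ab: "\<not> (a = 0 \<and> b = 0)" "of_int a * \<alpha> + of_int b * \<theta> \<in> \<int>"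
    unfolding resonant_def short_relation_def by blast
  then obtain c :: int where c: "of_int a * \<alpha> + of_int b * \<theta> = of_int c" by (auto elim: Ints_cases)
  have "b \<noteq> 0" using relation_coeff_nonzero[OF assms ab] .
  then have "\<theta> = (- of_int a / of_int b) * \<alpha> + of_int c / of_int b"
    using c by (simp add: field_simps)
  moreover have "- of_int a / of_int b \<in> (\<rat> :: real set)" "of_int c / of_int b \<in> (\<rat> :: real set)" by auto
  ultimately show "\<theta> \<in> {a * \<alpha> + b | a b. a \<in> \<rat> \<and> b \<in> \<rat>}" by blast
qed

text \<open>
  A short relation has a nonzero second coefficient, so it determines \<open>\<theta>\<close> from three integers, and
  for \<open>\<theta> \<in> {0..1}\<close> the third one is bounded as well.
\<close>

lemma finite_resonant:
  assumes "\<alpha> \<notin> \<rat>"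
  shows "finite (resonant \<alpha> N)"
proof -
  define C where "C = \<lceil>real N * \<bar>\<alpha>\<bar> + real N\<rceil>"
  let ?f = "\<lambda>(a :: int, b :: int, c :: int). (of_int c - of_int a * \<alpha>) / of_int b"
  have "resonant \<alpha> N \<subseteq> ?f ` ({- int N..int N} \<times> {- int N..int N} \<times> {- C..C})"
  proof
    fix \<theta> assume "\<theta> \<in> resonant \<alpha> N"
    then obtain a b :: int where ab: "\<bar>a\<bar> \<le> int N" "\<bar>b\<bar> \<le> int N" "\<not> (a = 0 \<and> b = 0)"
        "of_int a * \<alpha> + of_int b * \<theta> \<in> \<int>" and \<theta>: "0 \<le> \<theta>" "\<theta> \<le> 1"
      unfolding resonant_def short_relation_def by auto
    then obtain c :: int where c: "of_int a * \<alpha> + of_int b * \<theta> = of_int c" by (auto elim: Ints_cases)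
    have "\<bar>of_int a * \<alpha>\<bar> \<le> real N * \<bar>\<alpha>\<bar>" "\<bar>of_int b * \<theta>\<bar> \<le> real N * 1"
      unfolding abs_mult using ab \<theta> by (intro mult_mono; linarith)+
    then have "\<bar>of_int c\<bar> \<le> real N * \<bar>\<alpha>\<bar> + real N" unfolding c[symmetric] by linarith
    then have "\<bar>c\<bar> \<le> C" unfolding C_def by linarith
    moreover have "\<theta> = ?f (a, b, c)"
      using relation_coeff_nonzero[OF assms ab(3,4)] c by (simp add: field_simps)
    ultimately show "\<theta> \<in> ?f ` ({- int N..int N} \<times> {- int N..int N} \<times> {- C..C})"
      using ab by (intro image_eqI[of _ _ "(a, b, c)"]) auto
  qed
  then show ?thesis by (rule finite_subset) simp
qed

section \<open>Shrinking neighbourhoods of finite sets\<close>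

text \<open>
  The countable union of the sets \<open>B k\<close> may be dense, in which case a point close to
  \<open>B k\<close> for all large \<open>k\<close> need not belong to it in general. Suitable radii exclude this because they are chosen with the next set in view: when
  \<open>r k + r (Suc k)\<close> is at most the smallest gap of \<open>B (Suc k)\<close>, consecutive approximations to a
  point are forced to coincide.
\<close>

lemma finite_chain_shrinking_radii:
  fixes B :: "nat \<Rightarrow> real set"
  assumes fin: "\<And>k. finite (B k)" and mono: "mono B"
  shows "\<exists>r :: nat \<Rightarrow> real. (\<forall>k. r k > 0) \<and>
    (\<forall>x. (\<forall>\<^sub>F k in sequentially. \<exists>b \<in> B k. dist b x < r k) \<longrightarrow> x \<in> (\<Union>k. B k))"
proof -
  have "\<exists>e>0. \<forall>x\<in>B k. \<forall>y\<in>B k. dist x y < e \<longrightarrow> x = y" for k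
    using uniform_discrete_finite_iff[of "B k"] fin[of k] by (simp add: uniform_discrete_def)
  then obtain \<delta> where \<delta>: "\<And>k. \<delta> k > 0" "\<And>k x y. \<lbrakk>x \<in> B k; y \<in> B k; dist x y < \<delta> k\<rbrakk> \<Longrightarrow> x = y"
    by metis
  define r where "r k = min (1 / real (Suc k)) (Min (\<delta> ` {..Suc k}) / 2)" for k
  have r_pos: "r k > 0" for k using \<delta>(1) by (simp add: r_def)
  have r_le: "r k \<le> \<delta> j / 2" if "j \<le> Suc k" for j k
  proof -
    have "Min (\<delta> ` {..Suc k}) \<le> \<delta> j" using that by (intro Min_le) auto
    then show ?thesis by (simp add: r_def)
  qed
  have "x \<in> (\<Union>k. B k)" if ev: "\<forall>\<^sub>F k in sequentially. \<exists>b \<in> B k. dist b x < r k" for x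
  proof -
    from ev obtain K where "\<forall>k\<ge>K. \<exists>b \<in> B k. dist b x < r k" unfolding eventually_sequentially by blast
    then obtain b where b: "\<And>k. k \<ge> K \<Longrightarrow> b k \<in> B k" "\<And>k. k \<ge> K \<Longrightarrow> dist (b k) x < r k" by metis
    have b_eq: "b k = b K" if "k \<ge> K" for k
      using that
    proof (induction rule: dec_induct)
      case (step k)
      have "dist (b (Suc k)) (b k) \<le> dist (b (Suc k)) x + dist (b k) x" by (rule dist_triangle2)
      also have "\<dots> < r (Suc k) + r k" using b(2)[of k] b(2)[of "Suc k"] step by linarith
      also have "\<dots> \<le> \<delta> (Suc k)" using r_le[of "Suc k" k] r_le[of "Suc k" "Suc k"] by simp
      finally have "b (Suc k) = b k"
        using \<delta>(2)[of "b (Suc k)" "Suc k" "b k"] b(1)[of k] b(1)[of "Suc k"] step.hyps(1)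
          monoD[OF mono, of k "Suc k"] by auto
      then show ?case using step by simp
    qed simp
    have "dist (b K) x = 0"
    proof (rule ccontr)
      assume "dist (b K) x \<noteq> 0"
      then obtain j where j: "1 / real (Suc j) < dist (b K) x"
        using reals_Archimedean[of "dist (b K) x"] by (auto simp: inverse_eq_divide)
      have "dist (b K) x < r (max j K)" using b(2)[of "max j K"] b_eq[of "max j K"] by simp
      also have "\<dots> \<le> 1 / real (Suc (max j K))" by (simp add: r_def)
      also have "\<dots> \<le> 1 / real (Suc j)" by (simp add: field_simps)
      finally show False using j by simp
    qed
    then show ?thesis using b(1)[of K] by auto
  qed
  with r_pos show ?thesis by blast
qed

section \<open>Finite sets of multipliers\<close>

text \<open>
  Each \<open>m\<close> works on an open set of pairs \<open>(\<theta>, y)\<close>, and modulo one the targets \<open>y\<close> may be taken in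
  \<open>{0..1}\<close>, so the pairs to be covered form a compact set.
\<close>

lemma finite_uniform_approximation:
  fixes A :: "int set" and K :: "real set"
  assumes K: "compact K"
    and approx: "\<And>\<theta> y. \<theta> \<in> K \<Longrightarrow> \<exists>m\<in>A. int_norm (of_int m * \<theta> - y) < \<epsilon>"
  shows "\<exists>F \<subseteq> A. finite F \<and> (\<forall>\<theta>\<in>K. \<forall>y. \<exists>m\<in>F. int_norm (of_int m * \<theta> - y) < \<epsilon>)"
proof -
  define U where "U m = {p :: real \<times> real. int_norm (of_int m * fst p - snd p) < \<epsilon>}" for m :: int
  have U_open: "open (U m)" for m
  proof -
    have "U m = (\<Union>n :: int. {p. \<bar>of_int m * fst p - snd p - of_int n\<bar> < \<epsilon>})"
      by (auto simp: U_def int_norm_less_iff)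
    also have "open \<dots>" by (intro open_UN ballI open_Collect_less continuous_intros)
    finally show ?thesis .
  qed
  have cpt: "compact (K \<times> {0..1::real})" using K by (intro compact_Times) auto
  have cover: "K \<times> {0..1} \<subseteq> (\<Union>m\<in>A. U m)" using approx by (auto simp: U_def)
  obtain F where F: "F \<subseteq> A" "finite F" "K \<times> {0..1} \<subseteq> (\<Union>m\<in>F. U m)"
    by (rule compactE_image[OF cpt U_open cover])
  have "\<exists>m\<in>F. int_norm (of_int m * \<theta> - y) < \<epsilon>" if "\<theta> \<in> K" for \<theta> y
  proof -
    have "(\<theta>, frac y) \<in> K \<times> {0..1}" using that by (auto simp: frac_lt_1 less_imp_le)
    then have "(\<theta>, frac y) \<in> (\<Union>m\<in>F. U m)" using F(3) by blast
    then obtain m where m: "m \<in> F" "int_norm (of_int m * \<theta> - frac y) < \<epsilon>"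
      by (auto simp: U_def)
    have "of_int m * \<theta> - frac y = of_int m * \<theta> - y + of_int \<lfloor>y\<rfloor>" by (simp add: frac_def)
    with m show ?thesis using int_norm_add_of_int by metis
  qed
  with F show ?thesis by blast
qed

text \<open>
  The degree \<open>N\<close>, and with it the exceptional set, is fixed before the neighbourhood \<open>U\<close>. This order
  allows the radii of all stages to be chosen in terms of all the exceptional sets.
\<close>

lemma finite_multipliers_off_resonances:
  fixes \<alpha> \<epsilon> :: real
  assumes "\<epsilon> > 0"
  obtains N where "\<And>U. \<lbrakk>open U; resonant \<alpha> N \<subseteq> U\<rbrakk> \<Longrightarrow>
    \<exists>F :: int set. finite F \<and> (\<forall>m\<in>F. int_norm (of_int m * \<alpha>) < \<epsilon>) \<and>
      (\<forall>\<theta> \<in> {0..1} - U. \<forall>y. \<exists>m\<in>F. int_norm (of_int m * \<theta> - y) < \<epsilon>)"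
proof -
  obtain N :: nat where N: "\<And>\<alpha> \<theta> y :: real.
    \<not> short_relation N \<alpha> \<theta> \<Longrightarrow> \<exists>m::nat. int_norm (real m * \<alpha>) < \<epsilon> \<and> int_norm (real m * \<theta> - y) < \<epsilon>"
    using Kronecker_two_dim_bounded_relations[OF assms] by metis
  show thesis
  proof (rule that[of N])
    fix U :: "real set"
    assume U: "open U" "resonant \<alpha> N \<subseteq> U"
    let ?A = "{m :: int. int_norm (of_int m * \<alpha>) < \<epsilon>}"
    have "compact ({0..1} - U)" using U(1) by (intro compact_diff) auto
    moreover have "\<exists>m\<in>?A. int_norm (of_int m * \<theta> - y) < \<epsilon>" if "\<theta> \<in> {0..1} - U" for \<theta> y
    proof -
      have "\<theta> \<notin> resonant \<alpha> N" using that U(2) by blast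
      then have "\<exists>m::nat. int_norm (real m * \<alpha>) < \<epsilon> \<and> int_norm (real m * \<theta> - y) < \<epsilon>"
        using that by (intro N) (auto simp: resonant_def)
      then obtain m :: nat where "int_norm (real m * \<alpha>) < \<epsilon>" "int_norm (real m * \<theta> - y) < \<epsilon>" by blast
      then show ?thesis by (intro bexI[of _ "int m"]) auto
    qed
    ultimately have "\<exists>F \<subseteq> ?A. finite F \<and>
        (\<forall>\<theta> \<in> {0..1} - U. \<forall>y. \<exists>m\<in>F. int_norm (of_int m * \<theta> - y) < \<epsilon>)"
      by (rule finite_uniform_approximation)
    then show "\<exists>F :: int set. finite F \<and> (\<forall>m\<in>F. int_norm (of_int m * \<alpha>) < \<epsilon>) \<and>
      (\<forall>\<theta> \<in> {0..1} - U. \<forall>y. \<exists>m\<in>F. int_norm (of_int m * \<theta> - y) < \<epsilon>)"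
      by blast
  qed
qed

text \<open>
  Density at infinitely many stages, rather than at all late ones, is what can be achieved for every
  \<open>\<theta>\<close> outside the rational span simultaneously.
\<close>

lemma frequently_dense_multipliers:
  fixes \<alpha> :: real
  assumes irr: "\<alpha> \<notin> \<rat>"
  obtains F :: "nat \<Rightarrow> int set" where "\<And>k. finite (F k)" "\<And>k. F k \<noteq> {}"
    "\<And>k m. m \<in> F k \<Longrightarrow> int_norm (of_int m * \<alpha>) < 1 / real (Suc k)"
    "\<And>\<theta>. \<theta> \<notin> {a * \<alpha> + b | a b. a \<in> \<rat> \<and> b \<in> \<rat>} \<Longrightarrow>
       \<exists>\<^sub>F k in sequentially. \<forall>y. \<exists>m\<in>F k. int_norm (of_int m * \<theta> - y) < 1 / real (Suc k)"
proof -
  define good where "good k U F \<longleftrightarrow> finite F \<and> (\<forall>m\<in>F. int_norm (of_int m * \<alpha>) < 1 / real (Suc k)) \<and>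
      (\<forall>\<theta> \<in> {0..1} - U. \<forall>y. \<exists>m\<in>F. int_norm (of_int m * \<theta> - y) < 1 / real (Suc k))"
    for k U and F :: "int set"
  have "\<exists>N. \<forall>U. open U \<and> resonant \<alpha> N \<subseteq> U \<longrightarrow> (\<exists>F. good k U F)" for k
    unfolding good_def
    by (rule finite_multipliers_off_resonances[of "1 / real (Suc k)" \<alpha>]) (simp, blast)
  then obtain N where N: "\<And>k U. \<lbrakk>open U; resonant \<alpha> (N k) \<subseteq> U\<rbrakk> \<Longrightarrow> \<exists>F. good k U F"
    by metis
  \<comment> \<open>Partial sums make the bounds, and with them the exceptional sets, increase with the stage.\<close>
  define B where "B k = resonant \<alpha> (\<Sum>j\<le>k. N j)" for k
  have B_mono: "mono B"
    unfolding B_def by (intro monoI monoD[OF mono_resonant] sum_mono2) auto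
  have B_fin: "finite (B k)" for k unfolding B_def by (rule finite_resonant[OF irr])
  have B_res: "resonant \<alpha> (N k) \<subseteq> B k" for k
    unfolding B_def by (rule monoD[OF mono_resonant]) (simp add: member_le_sum)
  obtain r where r: "\<And>k. r k > 0"
    "\<And>x. \<forall>\<^sub>F k in sequentially. \<exists>b \<in> B k. dist b x < r k \<Longrightarrow> x \<in> (\<Union>k. B k)"
    using finite_chain_shrinking_radii[OF B_fin B_mono] by blast
  define U where "U k = (\<Union>b\<in>B k. ball b (r k))" for k
  have "open (U k)" "resonant \<alpha> (N k) \<subseteq> U k" for k
    using B_res[of k] r(1)[of k] by (auto simp: U_def intro!: bexI)
  then have "\<exists>F. good k (U k) F" for k by (rule N)
  then obtain F where "\<And>k. good k (U k) (F k)" by metis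
  then have F: "\<And>k. finite (F k)"
      "\<And>k m. m \<in> F k \<Longrightarrow> int_norm (of_int m * \<alpha>) < 1 / real (Suc k)"
      "\<And>k \<theta> y. \<theta> \<in> {0..1} - U k \<Longrightarrow> \<exists>m\<in>F k. int_norm (of_int m * \<theta> - y) < 1 / real (Suc k)"
    unfolding good_def by blast+
  \<comment> \<open>The multiplier \<open>0\<close> is always admissible and keeps the sets nonempty.\<close>
  show thesis
  proof (rule that[of "\<lambda>k. insert 0 (F k)"])
    show "int_norm (of_int m * \<alpha>) < 1 / real (Suc k)" if "m \<in> insert 0 (F k)" for m k
      using that F(2)[of m k] by (auto simp: int_norm_eq_round)
  next
    fix \<theta> :: real
    assume \<theta>: "\<theta> \<notin> {a * \<alpha> + b | a b. a \<in> \<rat> \<and> b \<in> \<rat>}"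
    have "frac \<theta> \<notin> {a * \<alpha> + b | a b. a \<in> \<rat> \<and> b \<in> \<rat>}"
    proof
      assume "frac \<theta> \<in> {a * \<alpha> + b | a b. a \<in> \<rat> \<and> b \<in> \<rat>}"
      then obtain a b where "frac \<theta> = a * \<alpha> + b" "a \<in> \<rat>" "b \<in> \<rat>" by blast
      then have "\<theta> = a * \<alpha> + (b + of_int \<lfloor>\<theta>\<rfloor>)" "a \<in> \<rat>" "b + of_int \<lfloor>\<theta>\<rfloor> \<in> \<rat>" 
        by (auto simp: frac_def)
      with \<theta> show False by blast
    qed
    then have "frac \<theta> \<notin> (\<Union>k. B k)"
      using resonant_subset_span[OF irr] unfolding B_def by blast
    then have "\<exists>\<^sub>F k in sequentially. frac \<theta> \<notin> U k"
      using r(2)[of "frac \<theta>"] unfolding U_def by (auto simp: frequently_def)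
    then show "\<exists>\<^sub>F k in sequentially. \<forall>y. \<exists>m\<in>insert 0 (F k). int_norm (of_int m * \<theta> - y) < 1 / real (Suc k)"
    proof (rule frequently_elim1, intro allI)
      fix k y
      assume "frac \<theta> \<notin> U k"
      then have "frac \<theta> \<in> {0..1} - U k" by (auto simp: frac_lt_1 less_imp_le)
      from F(3)[OF this] obtain m where m: "m \<in> F k" "int_norm (of_int m * frac \<theta> - y) < 1 / real (Suc k)" by blast
      have "of_int m * \<theta> - y = of_int m * frac \<theta> - y + of_int (m * \<lfloor>\<theta>\<rfloor>)"
        by (simp add: frac_def algebra_simps)
      with m have "int_norm (of_int m * \<theta> - y) < 1 / real (Suc k)" by (simp only: int_norm_add_of_int)
      with m(1) show "\<exists>m\<in>insert 0 (F k). int_norm (of_int m * \<theta> - y) < 1 / real (Suc k)" by blast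
    qed
  qed (use F(1) in auto)
qed

text \<open>
  An injective enumeration of the disjoint union of the sets leaves the union of the first \<open>k\<close> of
  them, which is finite, after finitely many steps.
\<close>

lemma enumerate_finite_sets:
  fixes F :: "nat \<Rightarrow> 'a :: countable set"
  assumes fin: "\<And>k. finite (F k)" and ne: "\<And>k. F k \<noteq> {}"
  obtains m :: "nat \<Rightarrow> 'a" where "range m = (\<Union>k. F k)"
    "\<And>k. \<forall>\<^sub>F l in sequentially. \<exists>j\<ge>k. m l \<in> F j"
proof -
  define S where "S = Sigma UNIV F"
  have "fst ` S = UNIV" using ne by (force simp: S_def)
  then have "infinite S" using finite_imageI[of S fst] by auto
  then have bij: "bij_betw (from_nat_into S) UNIV S" by (intro bij_betw_from_nat_into) auto
  let ?e = "from_nat_into S"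
  have range: "range ?e = S" and inj: "inj ?e" using bij by (auto simp: bij_betw_def)
  have in_F: "snd (?e l) \<in> F (fst (?e l))" for l
    using range unfolding S_def by (metis UNIV_I SigmaE fst_conv image_eqI snd_conv)
  show thesis
  proof (rule that[of "snd \<circ> ?e"])
    show "range (snd \<circ> ?e) = (\<Union>k. F k)"
      unfolding image_comp[symmetric] range by (force simp: S_def)
  next
    fix k
    have "finite (Sigma {..<k} F)" using fin by blast
    then have "finite (?e -` Sigma {..<k} F)" using inj by (rule finite_vimageI)
    then have "\<forall>\<^sub>F l in sequentially. l \<notin> ?e -` Sigma {..<k} F"
      unfolding cofinite_eq_sequentially[symmetric] eventually_cofinite by (simp add: vimage_def)
    then show "\<forall>\<^sub>F l in sequentially. \<exists>j\<ge>k. (snd \<circ> ?e) l \<in> F j"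
    proof eventually_elim
      case (elim l)
      then have "\<not> fst (?e l) < k" using in_F[of l] by (cases "?e l") auto
      then show ?case using in_F[of l] by (intro exI[of _ "fst (?e l)"]) auto
    qed
  qed
qed

section \<open>Density in the circle\<close>

lemma mod_one_add_of_int: "mod_one (x + of_int n) = mod_one x"
  by (simp add: mod_one_eq_iff)

text \<open>
  In the quotient topology the images of real balls form a basis: the preimage of such an image is
  the union of the integer translates of the ball.
\<close>

lemma closure_mod_one_image_eq_UNIV_iff:
  "closure (mod_one ` T) = UNIV \<longleftrightarrow> (\<forall>y. \<forall>\<epsilon>>0. \<exists>t\<in>T. int_norm (t - y) < \<epsilon>)"
proof
  assume dense: "closure (mod_one ` T) = UNIV"
  show "\<forall>y. \<forall>\<epsilon>>0. \<exists>t\<in>T. int_norm (t - y) < \<epsilon>"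
  proof (intro allI impI)
    fix y \<epsilon> :: real assume "\<epsilon> > 0"
    let ?U = "mod_one ` ball y \<epsilon>"
    have preimage: "mod_one -` ?U = {x. int_norm (x - y) < \<epsilon>}"
    proof (intro set_eqI iffI)
      fix x assume "x \<in> mod_one -` ?U"
      then obtain z where "\<bar>z - y\<bar> < \<epsilon>" "x - z \<in> \<int>" 
        by (auto simp: mod_one_eq_iff dist_real_def abs_minus_commute)
      moreover from this obtain n where "x - z = of_int n" by (auto elim: Ints_cases)
      ultimately have "\<bar>x - y - of_int n\<bar> < \<epsilon>" by linarith
      then show "x \<in> {x. int_norm (x - y) < \<epsilon>}" by (auto simp: int_norm_less_iff)
    next
      fix x assume "x \<in> {x. int_norm (x - y) < \<epsilon>}"
      then obtain n where "\<bar>x - y - of_int n\<bar> < \<epsilon>" by (auto simp: int_norm_less_iff)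
      then have "x - of_int n \<in> ball y \<epsilon>" by (simp add: dist_real_def abs_minus_commute algebra_simps)
      moreover have "mod_one x = mod_one (x - of_int n)" by (simp add: mod_one_eq_iff)
      ultimately show "x \<in> mod_one -` ?U" by auto
    qed
    have "open ?U"
    proof -
      have "{x. int_norm (x - y) < \<epsilon>} = (\<Union>n :: int. {x. \<bar>x - y - of_int n\<bar> < \<epsilon>})"
        by (auto simp: int_norm_less_iff)
      also have "open \<dots>" by (intro open_UN ballI open_Collect_less continuous_intros)
      finally show ?thesis unfolding open_circle_def preimage .
    qed
    moreover have "mod_one y \<in> ?U" using \<open>\<epsilon> > 0\<close> by (intro imageI) simp
    ultimately have "?U \<inter> mod_one ` T \<noteq> {}"
      using dense open_Int_closure_eq_empty[of ?U "mod_one ` T"] by blast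
    then obtain c where "c \<in> ?U" "c \<in> mod_one ` T" by blast
    moreover from this(2) obtain t where "c = mod_one t" "t \<in> T" by (rule imageE)
    ultimately have "t \<in> mod_one -` ?U" by simp
    with \<open>t \<in> T\<close> show "\<exists>t\<in>T. int_norm (t - y) < \<epsilon>" unfolding preimage by auto
  qed
next
  assume approx: "\<forall>y. \<forall>\<epsilon>>0. \<exists>t\<in>T. int_norm (t - y) < \<epsilon>"
  have "U \<inter> mod_one ` T \<noteq> {}" if "open U" "c \<in> U" for U c
  proof -
    obtain y where y: "c = mod_one y" by (induction c rule: circle.abs_induct) auto
    have "open (mod_one -` U)" using \<open>open U\<close> by (simp add: open_circle_def)
    then obtain \<epsilon> where \<epsilon>: "\<epsilon> > 0" "ball y \<epsilon> \<subseteq> mod_one -` U"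
      using \<open>c \<in> U\<close> y unfolding open_contains_ball by blast
    obtain t where t: "t \<in> T" "int_norm (t - y) < \<epsilon>" using approx \<epsilon>(1) by blast
    then obtain n where "\<bar>t - y - of_int n\<bar> < \<epsilon>" by (auto simp: int_norm_less_iff)
    then have "t + of_int (- n) \<in> ball y \<epsilon>" by (simp add: dist_real_def abs_minus_commute algebra_simps)
    then have "mod_one (t + of_int (- n)) \<in> U" using \<epsilon>(2) by blast
    then show ?thesis using t(1) unfolding mod_one_add_of_int by auto
  qed
  moreover have "open (- closure (mod_one ` T))" "- closure (mod_one ` T) \<inter> mod_one ` T = {}"
    using closure_subset[of "mod_one ` T"] by auto
  ultimately show "closure (mod_one ` T) = UNIV" by blast
qed

text \<open>
  With a common denominator \<open>d\<close> of \<open>a\<close> and \<open>b\<close>, the distance of \<open>d * m l * (a * \<alpha> + b)\<close> from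
  the integers tends to zero. Hence all but finitely many terms avoid the middle part of the interval
  between \<open>0\<close> and \<open>1 / d\<close>, and the remaining finitely many classes modulo one are countable,
  so they leave a point of that part uncovered.
\<close>

lemma not_dense_on_rational_span:
  fixes m :: "nat \<Rightarrow> int" and \<alpha> a b :: real
  assumes lim: "(\<lambda>l. int_norm (of_int (m l) * \<alpha>)) \<longlonglongrightarrow> 0" and "a \<in> \<rat>" "b \<in> \<rat>"
  shows "\<exists>y. \<exists>\<epsilon>>0. \<forall>l. \<epsilon> \<le> int_norm (of_int (m l) * (a * \<alpha> + b) - y)"
proof -
  obtain p q where pq: "q > 0" "a = of_int p / of_int q" using Rats_cases'[OF \<open>a \<in> \<rat>\<close>] by metis
  obtain p' q' where pq': "q' > 0" "b = of_int p' / of_int q'" using Rats_cases'[OF \<open>b \<in> \<rat>\<close>] by metis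
  define d where "d = q * q'"
  have d: "d > 0" using pq pq' by (simp add: d_def)
  define t where "t l = of_int (m l) * (a * \<alpha> + b)" for l
  have t: "of_int d * t l = of_int (p * q') * (of_int (m l) * \<alpha>) + of_int (m l * p' * q)" for l
  proof -
    have "of_int d * a = of_int (p * q')" "of_int d * b = of_int (p' * q)"
      using pq pq' by (simp_all add: d_def)
    moreover have "of_int d * t l = (of_int d * a) * (of_int (m l) * \<alpha>) + of_int (m l) * (of_int d * b)"
      by (simp add: t_def algebra_simps)
    ultimately show ?thesis by simp
  qed
  have "(\<lambda>l. \<bar>of_int (p * q')\<bar> * int_norm (of_int (m l) * \<alpha>)) \<longlonglongrightarrow> \<bar>of_int (p * q')\<bar> * 0"
    by (intro tendsto_mult tendsto_const lim)
  then have "\<forall>\<^sub>F l in sequentially. \<bar>of_int (p * q')\<bar> * int_norm (of_int (m l) * \<alpha>) < 1/8"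
    by (rule order_tendstoD) simp
  then have "\<forall>\<^sub>F l in sequentially. int_norm (of_int d * t l) < 1/8"
  proof eventually_elim
    case (elim l)
    then show ?case unfolding t int_norm_add_of_int
      by (rule le_less_trans[OF int_norm_of_int_mult_le])
  qed
  then obtain L where L: "\<And>l. l \<ge> L \<Longrightarrow> int_norm (of_int d * t l) < 1/8"
    unfolding eventually_sequentially by blast
  have "countable (\<Union>l<L. range (\<lambda>n :: int. t l + of_int n))" by auto
  moreover have "uncountable {3 / (8 * of_int d) <..< 5 / (8 * real_of_int d)}"
    using d by (simp add: uncountable_open_interval divide_strict_right_mono)
  \<comment> \<open>On this interval \<open>d * y\<close> is at distance at least \<open>3/8\<close> from the integers, whereas late terms of
    the sequence are within \<open>1/8\<close> after multiplication by \<open>d\<close>.\<close>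
  ultimately have "{3 / (8 * of_int d) <..< 5 / (8 * real_of_int d)} - (\<Union>l<L. range (\<lambda>n :: int. t l + of_int n)) \<noteq> {}"
    by (metis countable_empty uncountable_minus_countable)
  then obtain y where "y \<in> {3 / (8 * of_int d) <..< 5 / (8 * real_of_int d)} - (\<Union>l<L. range (\<lambda>n :: int. t l + of_int n))"
    by blast
  then have y: "3 / (8 * of_int d) < y" "y < 5 / (8 * of_int d)"
      "\<And>l n. l < L \<Longrightarrow> y \<noteq> t l + of_int n" by auto
  have dy: "3/8 < of_int d * y" "of_int d * y < 5/8" using y(1,2) d by (auto simp: field_simps)
  have y_far: "3/8 \<le> int_norm (of_int d * y)"
  proof -
    have "3/8 \<le> \<bar>of_int d * y - of_int n\<bar>" for n :: int
    proof (cases "n \<le> 0")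
      case True then show ?thesis using dy by linarith
    next
      case False then have "(1::real) \<le> of_int n" by linarith
      then show ?thesis using dy by linarith
    qed
    then show ?thesis unfolding int_norm_eq_round .
  qed
  define \<epsilon> where "\<epsilon> = Min (insert (1 / (4 * real_of_int d)) ((\<lambda>l. int_norm (t l - y)) ` {..<L}))"
  have "\<epsilon> > 0"
  proof -
    have "t l - y \<notin> \<int>" if "l < L" for l
    proof
      assume "t l - y \<in> \<int>"
      then obtain n where "t l - y = of_int n" by (rule Ints_cases)
      then have "y = t l + of_int (- n)" by simp
      with y(3)[OF that] show False by blast
    qed
    then show ?thesis using d by (auto simp: \<epsilon>_def int_norm_pos)
  qed
  moreover have "\<epsilon> \<le> int_norm (t l - y)" for l
  proof (cases "l < L")
    case True then show ?thesis unfolding \<epsilon>_def by (intro Min_le) auto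
  next
    case False
    have "3/8 \<le> int_norm (of_int d * t l) + int_norm (of_int d * (t l - y))"
      using y_far int_norm_triangle[of "of_int d * y" "of_int d * t l"] by (simp add: algebra_simps)
    also have "\<dots> < 1/8 + of_int d * int_norm (t l - y)"
      using L[of l] False int_norm_of_int_mult_le[of d "t l - y"] d by simp
    finally have "1 / (4 * real_of_int d) < int_norm (t l - y)" using d by (simp add: field_simps)
    moreover have "\<epsilon> \<le> 1 / (4 * real_of_int d)" unfolding \<epsilon>_def by (intro Min_le) auto
    ultimately show ?thesis by linarith
  qed
  ultimately show ?thesis unfolding t_def by blast
qed

section \<open>The sequence of multipliers\<close>

theorem theorem2:
  fixes \<alpha> :: real
  assumes "\<alpha> \<notin> \<rat>"
  shows "\<exists>m :: nat \<Rightarrow> int.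
           (\<lambda>l. int_norm (of_int (m l) * \<alpha>)) \<longlonglongrightarrow> 0 \<and>
           (\<forall>\<theta> :: real.
              closure {mod_one (of_int (m l) * \<theta>) | l. l \<in> UNIV} = UNIV \<longleftrightarrow>
              \<theta> \<notin> {a * \<alpha> + b | a b. a \<in> \<rat> \<and> b \<in> \<rat>})"
proof -
  let ?span = "{a * \<alpha> + b | a b. a \<in> \<rat> \<and> b \<in> \<rat>}"
  obtain F :: "nat \<Rightarrow> int set" where F: "\<And>k. finite (F k)" "\<And>k. F k \<noteq> {}"
    "\<And>k m. m \<in> F k \<Longrightarrow> int_norm (of_int m * \<alpha>) < 1 / real (Suc k)"
    "\<And>\<theta>. \<theta> \<notin> ?span \<Longrightarrow>
       \<exists>\<^sub>F k in sequentially. \<forall>y. \<exists>m\<in>F k. int_norm (of_int m * \<theta> - y) < 1 / real (Suc k)"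
    using frequently_dense_multipliers[OF assms] by blast
  obtain m :: "nat \<Rightarrow> int" where m: "range m = (\<Union>k. F k)"
    "\<And>k. \<forall>\<^sub>F l in sequentially. \<exists>j\<ge>k. m l \<in> F j"
    using enumerate_finite_sets[of F] F(1,2) by blast
  have small: "\<exists>k. \<forall>j\<ge>k. 1 / real (Suc j) < e" if "e > 0" for e :: real
  proof -
    obtain k where "1 / real (Suc k) < e"
      using reals_Archimedean[OF \<open>e > 0\<close>] by (auto simp: inverse_eq_divide)
    then have "1 / real (Suc j) < e" if "j \<ge> k" for j
      using that by (intro le_less_trans[of "1 / real (Suc j)" "1 / real (Suc k)"]) (auto simp: field_simps)
    then show ?thesis by blast
  qed
  have lim: "(\<lambda>l. int_norm (of_int (m l) * \<alpha>)) \<longlonglongrightarrow> 0"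
  proof (rule order_tendstoI)
    fix e :: real assume "e < 0"
    then show "\<forall>\<^sub>F l in sequentially. e < int_norm (of_int (m l) * \<alpha>)"
      by (intro always_eventually allI) (metis int_norm_nonneg less_le_trans)
  next
    fix e :: real assume "0 < e"
    then obtain k where k: "\<forall>j\<ge>k. 1 / real (Suc j) < e" using small by blast
    from m(2)[of k] show "\<forall>\<^sub>F l in sequentially. int_norm (of_int (m l) * \<alpha>) < e"
      by (rule eventually_mono) (meson F(3) k less_trans)
  qed
  have "closure {mod_one (of_int (m l) * \<theta>) | l. l \<in> UNIV} = UNIV \<longleftrightarrow> \<theta> \<notin> ?span" for \<theta>
  proof -
    have "{mod_one (of_int (m l) * \<theta>) | l. l \<in> UNIV} = mod_one ` range (\<lambda>l. of_int (m l) * \<theta>)" by auto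
    then have dense_iff: "closure {mod_one (of_int (m l) * \<theta>) | l. l \<in> UNIV} = UNIV \<longleftrightarrow>
        (\<forall>y. \<forall>e>0. \<exists>l. int_norm (of_int (m l) * \<theta> - y) < e)"
      by (simp add: closure_mod_one_image_eq_UNIV_iff)
    show ?thesis
    proof
      assume dense: "closure {mod_one (of_int (m l) * \<theta>) | l. l \<in> UNIV} = UNIV"
      show "\<theta> \<notin> ?span"
      proof
        assume "\<theta> \<in> ?span"
        then obtain y e where "e > 0" "\<forall>l. e \<le> int_norm (of_int (m l) * \<theta> - y)"
          using not_dense_on_rational_span[OF lim] by blast
        with dense show False unfolding dense_iff by (meson not_le)
      qed
    next
      assume "\<theta> \<notin> ?span"
      show "closure {mod_one (of_int (m l) * \<theta>) | l. l \<in> UNIV} = UNIV"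
        unfolding dense_iff
      proof (intro allI impI)
        fix y e :: real assume "e > 0"
        then obtain k where k: "\<forall>j\<ge>k. 1 / real (Suc j) < e" using small by blast
        obtain j where j: "j \<ge> k" "\<forall>y. \<exists>m\<in>F j. int_norm (of_int m * \<theta> - y) < 1 / real (Suc j)"
          using F(4)[OF \<open>\<theta> \<notin> ?span\<close>] unfolding frequently_sequentially by blast
        then obtain n where n: "n \<in> F j" "int_norm (of_int n * \<theta> - y) < 1 / real (Suc j)" by blast
        then obtain l where "n = m l" using m(1) by (metis UN_I UNIV_I rangeE)
        with n k j(1) show "\<exists>l. int_norm (of_int (m l) * \<theta> - y) < e" by (meson less_trans)
      qed
    qed
  qed
  with lim show ?thesis by blast
qed

end
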